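(* Let $n\ge 2$ and let $A\in\mathbb{R}^{n\times n}$ be symmetric positive definite with distinct eigenvalues $L=\lambda_1>\lambda_2>\cdots>\lambda_{n-1}>\lambda_n=\mu>0$, and let $\Lambda=\mathrm{Diag}(\lambda_1,\dots,\lambda_n)$. Let $\mathcal{F}_{\mathrm{HDM}}$ and $\mathcal{F}_{\mathrm{OSGM}}$ be the dynamical systems with parameter $\eta$ defined in the context, and let $\mathcal{J}_{\mathrm{HDM}}$ and $\mathcal{J}_{\mathrm{OSGM}}$ denote their Jacobians. Let $\alpha^\star=\tfrac{2}{L+\mu}$, $\hat z_1^\star=\gamma e_1+\delta e_n$, $\hat z_2^\star=-\gamma e_1+\delta e_n$, with $\gamma=\tfrac{\mu}{\sqrt{L^2+\mu^2}}$ and $\delta=\pm\tfrac{L}{\sqrt{L^2+\mu^2}}$ (either sign), so that $\{(\alpha^\star,\hat z_1^\star),(\alpha^\star,\hat z_2^\star)\}$ is a period-two orbit of both systems. Then for any $\eta\in(0,\tfrac1L]$ the spectral radii satisfy $$\rho\big(\mathcal{J}_{\mathrm{HDM}}(\alpha^\star,\hat z_1^\star)\,\mathcal{J}_{\mathrm{HDM}}(\alpha^\star,\hat z_2^\star)\big)<1\qquad\text{and}\qquad \rho\big(\mathcal{J}_{\mathrm{OSGM}}(\alpha^\star,\hat z_1^\star)\,\mathcal{J}_{\mathrm{OSGM}}(\alpha^\star,\hat z_2^\star)\big)>1 .$$ In other words, the orbit $\{(\alpha^\star,\hat z_1^\star),(\alpha^\star,\hat z_2^\star)\}$ is (linearly)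 stable for $\mathcal{F}_{\mathrm{HDM}}$ but unstable for $\mathcal{F}_{\mathrm{OSGM}}$.
   Context: $e_1,\dots,e_n$ is the standard basis of $\mathbb{R}^n$; $\rho(\cdot)$ is the spectral radius. For $\alpha\in\mathbb{R}$ and $\hat z\in\mathbb{R}^n\setminus\{0\}$ define $$\alpha^+(\hat z)=\alpha+\eta-\alpha\eta\,\frac{\langle \hat z,\Lambda^3\hat z\rangle}{\langle \hat z,\Lambda^2\hat z\rangle},$$ $$\mathcal{F}_{\mathrm{HDM}}(\alpha,\hat z)=\Big(\alpha^+(\hat z),\ \frac{(I-\alpha^+(\hat z)\Lambda)\hat z}{\|(I-\alpha^+(\hat z)\Lambda)\hat z\|}\Big),\qquad \mathcal{F}_{\mathrm{OSGM}}(\alpha,\hat z)=\Big(\alpha^+(\hat z),\ \frac{(I-\alpha\Lambda)\hat z}{\|(I-\alpha\Lambda)\hat z\|}\Big).$$ The Jacobians are the $(n+1)\times(n+1)$ Jacobian matrices of these maps regarded, via these formulas, as maps of $(\alpha,\hat z)\in\mathbb{R}\times\mathbb{R}^n$ (defined near the orbit points). A period-two orbit $\{s_1,s_2\}$ of a map with Jacobian $\mathcal{J}$ is called (linearly) stable if $\rho(\mathcal{J}(s_1)\mathcal{J}(s_2))<1$ and unstable if $\rho(\mathcal{J}(s_1)\mathcal{J}(s_2))>1$. *)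

theory Defs
  imports "HOL-Analysis.Analysis"
begin

definition diag_matrix :: "('n \<Rightarrow> real) \<Rightarrow> real^'n^'n" where
  "diag_matrix lam = (\<chi> i j. if i = j then lam i else 0)"

definition sym_pos_def :: "real^'n^'n \<Rightarrow> bool" where
  "sym_pos_def A \<longleftrightarrow> transpose A = A \<and> (\<forall>x. x \<noteq> 0 \<longrightarrow> 0 < inner x (A *v x))"

definition eigvals :: "'a::field^'n^'n \<Rightarrow> 'a set" where
  "eigvals A = {k. \<exists>v. v \<noteq> 0 \<and> A *v v = k *s v}"

text \<open>The spectral radius of a real matrix ranges over its complex eigenvalues. The set of
  eigenvalues is finite and non-empty, so the maximum exists.\<close>

definition spectral_rad :: "real^'n^'n \<Rightarrow> real" where
  "spectral_rad A = Max (cmod ` eigvals (map_matrix complex_of_real A))"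

definition alpha_next :: "real \<Rightarrow> real^'n^'n \<Rightarrow> real \<Rightarrow> real^'n \<Rightarrow> real" where
  "alpha_next eta Lam alpha z =
     alpha + eta - alpha * eta * (inner z ((Lam ** Lam ** Lam) *v z) / inner z ((Lam ** Lam) *v z))"

definition F_HDM :: "real \<Rightarrow> real^'n^'n \<Rightarrow> real \<times> (real^'n) \<Rightarrow> real \<times> (real^'n)" where
  "F_HDM eta Lam = (\<lambda>(alpha, z).
     let a = alpha_next eta Lam alpha z; w = (mat 1 - a *\<^sub>R Lam) *v z
     in (a, (1 / norm w) *\<^sub>R w))"

definition F_OSGM :: "real \<Rightarrow> real^'n^'n \<Rightarrow> real \<times> (real^'n) \<Rightarrow> real \<times> (real^'n)" where
  "F_OSGM eta Lam = (\<lambda>(alpha, z).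
     let w = (mat 1 - alpha *\<^sub>R Lam) *v z
     in (alpha_next eta Lam alpha z, (1 / norm w) *\<^sub>R w))"

text \<open>States \<open>(\<alpha>, z)\<close> are identified with vectors of length \<open>n + 1\<close>, indexed by \<open>'n option\<close>:
  the index \<open>None\<close> carries \<open>\<alpha>\<close> and \<open>Some i\<close> carries the \<open>i\<close>-th component of \<open>z\<close>.\<close>

definition state_vec :: "real \<times> (real^'n) \<Rightarrow> real^('n option)" where
  "state_vec s = (\<chi> i. case i of None \<Rightarrow> fst s | Some j \<Rightarrow> snd s $ j)"

definition vec_state :: "real^('n option) \<Rightarrow> real \<times> (real^'n)" where
  "vec_state v = (v $ None, \<chi> j. v $ Some j)"

definition state_jacobian ::
    "(real \<times> (real^'n) \<Rightarrow> real \<times> (real^'n)) \<Rightarrow> real \<times> (real^'n) \<Rightarrow> real^('n option)^('n option)" where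
  "state_jacobian F s = jacobian (state_vec \<circ> F \<circ> vec_state) (at (state_vec s))"

definition period_two_orbit :: "('a \<Rightarrow> 'a) \<Rightarrow> 'a \<Rightarrow> 'a \<Rightarrow> bool" where
  "period_two_orbit F s1 s2 \<longleftrightarrow> s1 \<noteq> s2 \<and> F s1 = s2 \<and> F s2 = s1"

end

theory Submission
  imports Defs
begin

text \<open>
  At both orbit points the Jacobian acts diagonally, by the factors \<open>(1 - \<alpha> \<lambda>\<^sub>j) / \<kappa>\<close> with
  \<open>\<kappa> = (L - \<mu>) / (L + \<mu>)\<close>, on the coordinates other than \<open>\<alpha>\<close>, \<open>e\<^sub>1\<close>, \<open>e\<^sub>n\<close>; these factors have
  modulus less than 1. On the remaining three coordinates the radial direction is killed, since
  both maps are invariant under positive scaling of \<open>z\<close>, so a \<open>2 \<times> 2\<close> block on \<open>\<alpha>\<close> and the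
  tangential direction is left. The reflection \<open>e\<^sub>1 \<mapsto> -e\<^sub>1\<close> commutes with both systems and swaps the
  orbit points, so the block of the product of the Jacobians is a square \<open>M\<^sup>2\<close>. With \<open>\<theta> = \<eta> (L + \<mu>)\<close>,
  which lies in \<open>(0, 2)\<close>, one finds \<open>det M = 1 - \<theta>/2\<close> and \<open>tr M = 2 - 3\<theta>/2\<close> for HDM, so that the
  Schur-Cohn criterion gives stability, whereas \<open>det M = 1 + \<theta>/2 > 1\<close> for OSGM forces an eigenvalue
  outside the closed unit disc.
\<close>

section \<open>Derivatives of normalization and of the step-size update\<close>

text \<open>Differentiating the direction of \<open>f\<close> projects \<open>f'\<close> onto the
  orthogonal complement of \<open>f x\<close> and rescales by the norm.\<close>

lemma has_derivative_normalize:
  fixes f :: "'a::real_normed_vector \<Rightarrow> 'b::real_inner"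
  assumes f: "(f has_derivative f') (at x)" and nz: "f x \<noteq> 0"
  shows "((\<lambda>y. (1 / norm (f y)) *\<^sub>R f y) has_derivative
    (\<lambda>h. (1 / norm (f x)) *\<^sub>R (f' h - inner (sgn (f x)) (f' h) *\<^sub>R sgn (f x)))) (at x)"
proof -
  have n: "((\<lambda>y. norm (f y)) has_derivative (\<lambda>h. inner (f' h) (sgn (f x)))) (at x)"
    using has_derivative_compose[OF f has_derivative_norm[OF nz]] .
  show ?thesis
    by (rule has_derivative_eq_rhs, (rule derivative_intros n f)+)
       (use nz f in \<open>auto simp: fun_eq_iff sgn_div_norm scaleR_diff_right inner_commute
          divide_inverse mult_ac\<close>)
qed

lemma diag_matrix_mult_vec: "diag_matrix f *v x = (\<chi> j. f j * x $ j)"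
  by (simp add: diag_matrix_def matrix_vector_mult_def vec_eq_iff if_distrib [of "\<lambda>x. x * _"] cong: if_cong)

lemma diag_matrix_mult: "diag_matrix f ** diag_matrix g = diag_matrix (\<lambda>j. f j * g j)"
  by (simp add: diag_matrix_def matrix_matrix_mult_def vec_eq_iff if_distrib [of "\<lambda>x. x * _"]
      if_distrib [of "\<lambda>x. _ * x"] cong: if_cong)

lemma alpha_next_diag_matrix:
  "alpha_next eta (diag_matrix f) a z = a + eta - a * eta *
    (inner z (diag_matrix (\<lambda>j. f j ^ 3) *v z) / inner z (diag_matrix (\<lambda>j. f j ^ 2) *v z))"
  by (simp add: alpha_next_def diag_matrix_mult power2_eq_square power3_eq_cube)

lemma has_derivative_quadratic_form:
  fixes f :: "'n::finite \<Rightarrow> real"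
  shows "((\<lambda>z. inner z (diag_matrix f *v z)) has_derivative
    (\<lambda>k. 2 * inner k (diag_matrix f *v z))) (at z)"
proof -
  have B: "bounded_linear ((*v) (diag_matrix f))" by simp
  show ?thesis
    by (rule has_derivative_eq_rhs, rule has_derivative_inner[OF has_derivative_ident
          bounded_linear.has_derivative[OF B has_derivative_ident]])
       (auto simp: fun_eq_iff inner_vec_def diag_matrix_mult_vec sum.distrib[symmetric]
          sum_distrib_left intro!: sum.cong)
qed

lemma has_derivative_alpha_next:
  fixes f :: "'n::finite \<Rightarrow> real" and z :: "real^'n"
  defines "N3 \<equiv> \<lambda>z. inner z (diag_matrix (\<lambda>j. f j ^ 3) *v z)"
    and "N2 \<equiv> \<lambda>z. inner z (diag_matrix (\<lambda>j. f j ^ 2) *v z)"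
  assumes nz: "N2 z \<noteq> 0"
  shows "((\<lambda>s. alpha_next eta (diag_matrix f) (fst s) (snd s)) has_derivative
    (\<lambda>h. fst h * (1 - eta * (N3 z / N2 z)) - a * eta * (2 / N2 z) *
       (inner (snd h) (diag_matrix (\<lambda>j. f j ^ 3) *v z)
        - N3 z / N2 z * inner (snd h) (diag_matrix (\<lambda>j. f j ^ 2) *v z)))) (at (a, z))"
proof -
  have comp: "((\<lambda>s::real \<times> (real^'n). inner (snd s) (diag_matrix g *v snd s)) has_derivative
    (\<lambda>h. 2 * inner (snd h) (diag_matrix g *v z))) (at (a, z))" for g :: "'n \<Rightarrow> real"
    by (rule has_derivative_compose[OF has_derivative_snd[OF has_derivative_ident]])
       (simp add: has_derivative_quadratic_form)
  show ?thesis
    unfolding alpha_next_diag_matrix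
    by (rule has_derivative_eq_rhs, (rule derivative_intros comp)+)
       (use nz in \<open>auto simp: fun_eq_iff N2_def N3_def field_simps\<close>)
qed


section \<open>Action of the Jacobian matrix on real and complex vectors\<close>

lemma vec_state_state_vec [simp]: "vec_state (state_vec s) = s"
  by (simp add: vec_state_def state_vec_def prod_eq_iff vec_eq_iff)

lemma bounded_linear_state_vec: "bounded_linear (state_vec :: real \<times> (real^'n::finite) \<Rightarrow> _)"
  by (rule linear_conv_bounded_linear[THEN iffD1], unfold_locales)
     (auto simp: state_vec_def vec_eq_iff split: option.split)

lemma bounded_linear_vec_state: "bounded_linear (vec_state :: _ \<Rightarrow> real \<times> (real^'n::finite))"
  by (rule linear_conv_bounded_linear[THEN iffD1], unfold_locales)
     (auto simp: vec_state_def vec_eq_iff prod_eq_iff)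

text \<open>The coordinate maps are linear, so by the chain rule and uniqueness of derivatives the
  matrix acts as \<open>F'\<close>; no matrix entries have to be computed.\<close>

lemma state_jacobian_mult_vec:
  fixes F :: "real \<times> (real^'n::finite) \<Rightarrow> real \<times> (real^'n)"
  assumes F: "(F has_derivative F') (at s)"
  shows "state_jacobian F s *v y = state_vec (F' (vec_state y))"
proof -
  have 1: "((\<lambda>v. F (vec_state v)) has_derivative (\<lambda>y. F' (vec_state y))) (at (state_vec s))"
    by (rule has_derivative_compose[OF
          bounded_linear_imp_has_derivative[OF bounded_linear_vec_state]]) (simp add: F)
  have "((state_vec \<circ> F \<circ> vec_state) has_derivative (\<lambda>y. state_vec (F' (vec_state y))))
      (at (state_vec s))"
    using bounded_linear.has_derivative[OF bounded_linear_state_vec 1] by (simp add: o_def)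
  then show ?thesis
    unfolding state_jacobian_def
    by (metis differentiableI has_derivative_unique jacobian_works)
qed

lemma map_matrix_of_real_mult_vec:
  "(map_matrix complex_of_real J *v v) $ i =
    Complex ((J *v (\<chi> j. Re (v $ j))) $ i) ((J *v (\<chi> j. Im (v $ j))) $ i)"
  by (simp add: matrix_vector_mult_def complex_eq_iff)

lemma map_matrix_of_real_mult:
  "map_matrix complex_of_real (J ** K) = map_matrix complex_of_real J ** map_matrix complex_of_real K"
  by (simp add: matrix_matrix_mult_def vec_eq_iff)

section \<open>Roots of quadratics and the unit disc\<close>

lemma complex_quadratic_factor:
  fixes p q :: complex
  obtains r1 r2 where "\<And>k. k\<^sup>2 - p * k + q = (k - r1) * (k - r2)" "r1 * r2 = q"
proof -
  define d where "d = csqrt (p\<^sup>2 - 4 * q)"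
  have d: "d\<^sup>2 = p\<^sup>2 - 4 * q" by (simp add: d_def)
  have 1: "k\<^sup>2 - p * k + q = (k - (p + d) / 2) * (k - (p - d) / 2)" for k
    using d by (simp add: field_simps power2_eq_square)
  have 2: "(p + d) / 2 * ((p - d) / 2) = q"
    using d by (simp add: field_simps power2_eq_square)
  show thesis using that[OF 1 2] .
qed

text \<open>Schur-Cohn criterion in degree two. Non-real roots are conjugate with product
  \<open>q\<close>. At a real \<open>x\<close> with modulus at least 1 the polynomial is positive,
  since it exceeds \<open>(\<bar>x\<bar> - 1) * (\<bar>x\<bar> - q)\<close>.\<close>

lemma quadratic_roots_in_unit_disc:
  fixes p q :: real and k :: complex
  assumes "\<bar>p\<bar> < 1 + q" "q < 1" and k: "k\<^sup>2 - of_real p * k + of_real q = 0"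
  shows "cmod k < 1"
proof (cases "Im k = 0")
  case True
  define x where "x = Re k"
  have kx: "k = of_real x" using True by (simp add: x_def complex_eq_iff)
  have "of_real (x\<^sup>2 - p * x + q) = (0::complex)" using k by (simp add: kx)
  then have x: "x\<^sup>2 - p * x + q = 0" by (simp only: of_real_eq_0_iff)
  have "\<not> 1 \<le> x"
  proof
    assume "1 \<le> x"
    then have "0 \<le> (x - 1) * (x - q)" "p * x < (1 + q) * x"
      using assms by (auto intro!: mult_nonneg_nonneg mult_strict_right_mono)
    with x show False by (simp add: algebra_simps power2_eq_square)
  qed
  moreover have "\<not> x \<le> - 1"
  proof
    assume "x \<le> - 1"
    then have "0 \<le> (- x - 1) * (- x - q)"
      using assms by (intro mult_nonneg_nonneg) auto
    moreover have "(- p) * (- x) < (1 + q) * (- x)"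
      using assms \<open>x \<le> - 1\<close> by (intro mult_strict_right_mono) auto
    ultimately show False using x by (simp add: algebra_simps power2_eq_square)
  qed
  ultimately show ?thesis by (simp add: kx)
next
  case False
  have "Re k * Re k - Im k * Im k - p * Re k + q = 0" "2 * Re k * Im k - p * Im k = 0"
    using arg_cong[OF k, of Re] arg_cong[OF k, of Im] by (simp_all add: power2_eq_square)
  then have "p = 2 * Re k" "(Re k)\<^sup>2 + (Im k)\<^sup>2 = q"
    using False by (auto simp: power2_eq_square)
  then show ?thesis using assms(2) by (simp add: cmod_def)
qed


section \<open>Derivatives along the two-cycle\<close>

text \<open>The sign of \<open>del\<close> is left open. All that is used of the formulas for \<open>gam\<close> and \<open>del\<close> is that
  \<open>z\<close> is a unit vector on which the components of \<open>\<Lambda>z\<close> along \<open>e\<^sub>1\<close> and \<open>e\<^sub>n\<close> have equal modulus.\<close>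

locale two_cycle =
  fixes lam :: "'n::finite \<Rightarrow> real" and i1 iN :: 'n and L mu eta gam del :: real
  assumes mu_pos: "0 < mu" and mu_less: "mu < L"
    and lam_i1: "lam i1 = L" and lam_iN: "lam iN = mu"
    and lam_between: "\<And>j. j \<noteq> i1 \<Longrightarrow> j \<noteq> iN \<Longrightarrow> mu < lam j \<and> lam j < L"
    and eta_pos: "0 < eta" and eta_le: "eta \<le> 1 / L"
    and gam_nz: "gam \<noteq> 0" and del_nz: "del \<noteq> 0"
    and unit: "gam\<^sup>2 + del\<^sup>2 = 1" and balance: "L\<^sup>2 * gam\<^sup>2 = mu\<^sup>2 * del\<^sup>2"
begin

abbreviation "Lam \<equiv> diag_matrix lam"

definition "alpha = 2 / (L + mu)"
definition "kap = (L - mu) / (L + mu)"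
text \<open>Up to sign, \<open>m\<close> is the tangential response to a change of the step size,
  while \<open>beta\<close> and \<open>c\<close> are the responses of the updated step size to
  tangential motion and to \<open>\<alpha>\<close>.\<close>

definition "m = (L + mu) * gam * del / kap"
definition "beta = eta * kap / (gam * del)"
definition "c = 1 - eta * (L + mu) / 2"

text \<open>The orbit points are \<open>z 1\<close> and \<open>z (- 1)\<close>; the parameter \<open>e\<close> below is always one of these signs.\<close>

definition z :: "real \<Rightarrow> real^'n" where
  "z e = (e * gam) *\<^sub>R axis i1 1 + del *\<^sub>R axis iN 1"

text \<open>Coordinate along the unit vector \<open>del e1 - e gam eN\<close>, which is orthogonal
  to \<open>z e\<close> when \<open>e\<close> is a sign.\<close>

definition tang :: "real \<Rightarrow> real^'n \<Rightarrow> real" where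
  "tang e x = del * x $ i1 - e * gam * x $ iN"

definition dalpha :: "real \<Rightarrow> real \<times> (real^'n) \<Rightarrow> real" where
  "dalpha e h = c * fst h - beta * e * tang e (snd h)"

text \<open>Here \<open>g\<close> is the increment of the step size used in the \<open>z\<close>-update: \<open>dalpha\<close> for HDM, and the
  increment of the old \<open>\<alpha>\<close> for OSGM. The vector \<open>del e\<^sub>1 + e gam e\<^sub>n\<close> is tangent at the image \<open>z (- e)\<close>.\<close>

definition dz :: "real \<Rightarrow> real \<Rightarrow> real^'n \<Rightarrow> real^'n" where
  "dz e g x = (let t = - tang e x - g * e * m in
     (\<chi> j. if j = i1 then del * t else if j = iN then e * gam * t
           else (1 - alpha * lam j) / kap * x $ j))"

lemma pos: "0 < L" "0 < L + mu" "0 < L - mu" "0 < kap"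
  using mu_pos mu_less by (auto simp: kap_def)

lemma i1_neq_iN: "i1 \<noteq> iN"
  using mu_less lam_i1 lam_iN by auto

lemma alpha_eqs: "1 - alpha * L = - kap" "1 - alpha * mu = kap" "alpha * (L + mu) = 2"
  using pos by (simp_all add: alpha_def kap_def field_simps)

lemma z_nth: "z e $ j = (if j = i1 then e * gam else if j = iN then del else 0)"
  using i1_neq_iN by (simp add: z_def axis_def)

lemma inner_z: "inner (z e) x = e * gam * x $ i1 + del * x $ iN"
  by (simp add: z_def inner_add_left inner_axis')

lemma norm_z: "e * e = 1 \<Longrightarrow> norm (z e) = 1"
proof -
  assume e: "e * e = 1"
  have "inner (z e) (z e) = (e * e) * gam\<^sup>2 + del\<^sup>2"
    using i1_neq_iN by (simp add: inner_z z_nth power2_eq_square)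
  then show ?thesis using e unit by (simp add: norm_eq_sqrt_inner)
qed

text \<open>The factors on \<open>e1\<close> and \<open>eN\<close> are \<open>- kap\<close> and
  \<open>kap\<close>, so the step is a reflection times \<open>kap\<close>.\<close>

lemma contraction_z: "z e - alpha *\<^sub>R (Lam *v z e) = kap *\<^sub>R z (- e)"
proof -
  have "(1 - alpha * L) * (e * gam) = kap * (- e * gam)" "(1 - alpha * mu) * del = kap * del"
    by (simp_all only: alpha_eqs)
  then show ?thesis using i1_neq_iN
    by (auto simp: vec_eq_iff z_nth diag_matrix_mult_vec lam_i1 lam_iN algebra_simps)
qed

lemma mat_diff_scale: "(mat 1 - a *\<^sub>R Lam) *v x = x - a *\<^sub>R (Lam *v x)"
  by (simp add: matrix_vector_mult_diff_rdistrib scaleR_matrix_vector_assoc)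

text \<open>By \<open>balance\<close> both components contribute equally to the form of
  \<open>\<Lambda>^2\<close>, so the quotient of the two forms is the mean of \<open>L\<close> and
  \<open>mu\<close>.\<close>

lemma quadratic_forms:
  assumes e: "e * e = 1"
  shows "inner (z e) (diag_matrix (\<lambda>j. lam j ^ 2) *v z e) = 2 * (L\<^sup>2 * gam\<^sup>2)"
    and "inner (z e) (diag_matrix (\<lambda>j. lam j ^ 3) *v z e) = (L + mu) * (L\<^sup>2 * gam\<^sup>2)"
proof -
  have "inner (z e) (diag_matrix (\<lambda>j. lam j ^ 2) *v z e) = (e * e) * L\<^sup>2 * gam\<^sup>2 + mu\<^sup>2 * del\<^sup>2"
    using i1_neq_iN
    by (simp add: inner_z z_nth diag_matrix_mult_vec lam_i1 lam_iN power2_eq_square)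
  then show "inner (z e) (diag_matrix (\<lambda>j. lam j ^ 2) *v z e) = 2 * (L\<^sup>2 * gam\<^sup>2)"
    using balance e by simp
  have "inner (z e) (diag_matrix (\<lambda>j. lam j ^ 3) *v z e)
      = (e * e) * L * (L\<^sup>2 * gam\<^sup>2) + mu * (mu\<^sup>2 * del\<^sup>2)"
    using i1_neq_iN
    by (simp add: inner_z z_nth diag_matrix_mult_vec lam_i1 lam_iN power2_eq_square power3_eq_cube)
  then show "inner (z e) (diag_matrix (\<lambda>j. lam j ^ 3) *v z e) = (L + mu) * (L\<^sup>2 * gam\<^sup>2)"
    using balance e by (simp add: algebra_simps)
qed

lemma alpha_next_z:
  assumes "e * e = 1"
  shows "alpha_next eta Lam alpha (z e) = alpha"
proof -
  have "(L + mu) * (L\<^sup>2 * gam\<^sup>2) / (2 * (L\<^sup>2 * gam\<^sup>2)) = (L + mu) / 2"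
    using pos gam_nz by simp
  then have "alpha_next eta Lam alpha (z e) = alpha + eta - eta * (alpha * (L + mu)) / 2"
    unfolding alpha_next_diag_matrix quadratic_forms[OF assms]
    by (simp only: mult_ac) (simp add: mult_ac)
  then show ?thesis by (simp add: alpha_eqs)
qed

lemma orbit:
  assumes "e * e = 1"
  shows "F_HDM eta Lam (alpha, z e) = (alpha, z (- e))"
    and "F_OSGM eta Lam (alpha, z e) = (alpha, z (- e))"
proof -
  have "(1 / norm (kap *\<^sub>R z (- e))) *\<^sub>R kap *\<^sub>R z (- e) = z (- e)"
    using pos norm_z[of "- e"] assms by simp
  then show "F_HDM eta Lam (alpha, z e) = (alpha, z (- e))"
    and "F_OSGM eta Lam (alpha, z e) = (alpha, z (- e))"
    using alpha_next_z[OF assms]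
    by (simp_all add: F_HDM_def F_OSGM_def Let_def mat_diff_scale contraction_z)
qed

lemma has_derivative_alpha_next_z:
  assumes e: "e * e = 1"
  shows "((\<lambda>s. alpha_next eta Lam (fst s) (snd s)) has_derivative dalpha e) (at (alpha, z e))"
proof -
  have nz: "inner (z e) (diag_matrix (\<lambda>j. lam j ^ 2) *v z e) \<noteq> 0"
    using quadratic_forms[OF e] pos gam_nz by simp
  have q: "(L + mu) * (L\<^sup>2 * gam\<^sup>2) / (2 * (L\<^sup>2 * gam\<^sup>2)) = (L + mu) / 2"
    using pos gam_nz by simp
  \<comment> \<open>\<open>w\<close> is the common ratio expressing \<open>balance\<close> linearly;
    it turns the derivative of the quotient into a multiple of \<open>tang\<close>.\<close>
  define w where "w = L\<^sup>2 * gam / del"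
  have w: "L\<^sup>2 * gam = w * del" "mu\<^sup>2 * del = w * gam" "w \<noteq> 0"
    using balance del_nz gam_nz pos by (auto simp: w_def field_simps power2_eq_square)
  have inn: "inner x (diag_matrix f *v z e) = x $ i1 * f i1 * e * gam + x $ iN * f iN * del" for x f
    using inner_z[of e "\<chi> j. f j * x $ j"]
    by (simp add: inner_vec_def diag_matrix_mult_vec mult_ac)
  have 3: "inner x (diag_matrix (\<lambda>j. lam j ^ 3) *v z e)
        - (L + mu) / 2 * inner x (diag_matrix (\<lambda>j. lam j ^ 2) *v z e)
      = (L - mu) / 2 * w * e * tang e x" for x
  proof -
    have "inner x (diag_matrix (\<lambda>j. lam j ^ 3) *v z e)
        - (L + mu) / 2 * inner x (diag_matrix (\<lambda>j. lam j ^ 2) *v z e)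
      = (L - mu) / 2 * (e * x $ i1 * (L\<^sup>2 * gam) - x $ iN * (mu\<^sup>2 * del))"
      by (simp add: inn lam_i1 lam_iN power2_eq_square power3_eq_cube field_simps)
    also have "\<dots> = (L - mu) / 2 * (e * x $ i1 * (w * del) - (e * e) * x $ iN * (w * gam))"
      by (simp only: w e) simp
    also have "\<dots> = (L - mu) / 2 * w * e * tang e x"
      by (simp add: tang_def field_simps)
    finally show ?thesis .
  qed
  have den: "2 * (L\<^sup>2 * gam\<^sup>2) = 2 * w * gam * del"
    using w(1) by (simp add: power2_eq_square algebra_simps)
  have "2 / r * eta * (2 / (2 * w * gam * del)) * (d / 2 * w) = eta * (d / r) / (gam * del)"
    if "r \<noteq> 0" for r d
    using that w(3) gam_nz del_nz by (simp add: field_simps)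
  then have coef: "alpha * eta * (2 / (2 * w * gam * del)) * ((L - mu) / 2 * w) = beta"
    using pos(2) by (simp add: alpha_def beta_def kap_def)
  show ?thesis
  proof (rule has_derivative_eq_rhs[OF has_derivative_alpha_next[OF nz]], rule ext)
    fix h :: "real \<times> (real^'n)"
    show "fst h * (1 - eta * (inner (z e) (diag_matrix (\<lambda>j. lam j ^ 3) *v z e) /
          inner (z e) (diag_matrix (\<lambda>j. lam j ^ 2) *v z e)))
        - alpha * eta * (2 / inner (z e) (diag_matrix (\<lambda>j. lam j ^ 2) *v z e)) *
          (inner (snd h) (diag_matrix (\<lambda>j. lam j ^ 3) *v z e)
           - inner (z e) (diag_matrix (\<lambda>j. lam j ^ 3) *v z e) /
             inner (z e) (diag_matrix (\<lambda>j. lam j ^ 2) *v z e)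
             * inner (snd h) (diag_matrix (\<lambda>j. lam j ^ 2) *v z e)) = dalpha e h"
      unfolding quadratic_forms[OF e] q 3
      unfolding den dalpha_def c_def coef[symmetric] 
      by (simp only: mult.assoc times_divide_eq_right [symmetric]) (simp only: mult.commute)
  qed
qed

text \<open>Keeping the step size \<open>a\<close> general serves both systems: the updated value
  for HDM, the old \<open>\<alpha>\<close> for OSGM.\<close>

lemma has_derivative_normalized_step:
  assumes e: "e * e = 1" and a: "(a has_derivative a') (at (alpha, z e))"
    and az: "a (alpha, z e) = alpha"
  shows "((\<lambda>s. (1 / norm ((mat 1 - a s *\<^sub>R Lam) *v snd s)) *\<^sub>R ((mat 1 - a s *\<^sub>R Lam) *v snd s))
    has_derivative (\<lambda>h. dz e (a' h) (snd h))) (at (alpha, z e))"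
proof -
  let ?s = "(alpha, z e)"
  have B: "bounded_linear ((*v) Lam)" by simp
  let ?w = "\<lambda>s. snd s - a s *\<^sub>R (Lam *v snd s)"
  let ?u = "\<lambda>h. snd h - (alpha *\<^sub>R (Lam *v snd h) + a' h *\<^sub>R (Lam *v z e))"
  have w: "(?w has_derivative ?u) (at ?s)"
    by (rule has_derivative_eq_rhs, (rule derivative_intros a bounded_linear.has_derivative[OF B])+)
       (simp add: az)
  have ws: "?w ?s = kap *\<^sub>R z (- e)"
    by (simp add: az contraction_z)
  have n: "norm (z (- e)) = 1" using norm_z[of "- e"] e by simp
  have nz: "?w ?s \<noteq> 0"
    unfolding ws using pos n by auto
  have sg: "sgn (?w ?s) = z (- e)" "norm (?w ?s) = kap"
    unfolding ws using pos n by (simp_all add: sgn_div_norm)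
  have "(1 / kap) *\<^sub>R (?u h - inner (z (- e)) (?u h) *\<^sub>R z (- e)) = dz e (a' h) (snd h)" for h
  proof -
    define g x where "g = a' h" and "x = snd h"
    define u where "u = ?u h"
    have u1: "u $ i1 = - kap * x $ i1 - g * L * e * gam"
    proof -
      have "u $ i1 = (1 - alpha * L) * x $ i1 - g * L * e * gam"
        by (simp add: u_def diag_matrix_mult_vec z_nth lam_i1 g_def x_def algebra_simps)
      then show ?thesis by (simp only: alpha_eqs)
    qed
    have uN: "u $ iN = kap * x $ iN - g * mu * del"
    proof -
      have "u $ iN = (1 - alpha * mu) * x $ iN - g * mu * del"
        using i1_neq_iN
        by (simp add: u_def diag_matrix_mult_vec z_nth lam_iN g_def x_def algebra_simps)
      then show ?thesis by (simp only: alpha_eqs)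
    qed
    define t where "t = - tang e x - g * e * m"
    have mk: "m * kap = (L + mu) * gam * del" using pos by (simp add: m_def)
    \<comment> \<open>\<open>kap * t\<close> is the component of \<open>u\<close> along the tangent
      vector at \<open>z (- e)\<close>; within the plane of \<open>e1\<close> and \<open>eN\<close>
      only this component survives the projection.\<close>
    have tk: "del * u $ i1 + e * gam * u $ iN = kap * t"
    proof -
      have "kap * t = - kap * tang e x - g * e * (m * kap)" by (simp add: t_def algebra_simps)
      then show ?thesis unfolding mk by (simp add: u1 uN tang_def algebra_simps)
    qed
    have "(1 / kap) * (u $ j - inner (z (- e)) u * z (- e) $ j) = dz e g x $ j" for j
    proof -
      consider "j = i1" | "j = iN" | "j \<noteq> i1" "j \<noteq> iN" by blast
      then show ?thesis
      proof cases
        case 1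
        have "u $ i1 - inner (z (- e)) u * z (- e) $ i1
            = (1 - (e * e) * gam\<^sup>2) * u $ i1 + e * gam * del * u $ iN"
          by (simp add: inner_z z_nth algebra_simps power2_eq_square)
        also have "\<dots> = del * (del * u $ i1 + e * gam * u $ iN)"
          using unit by (simp add: e algebra_simps power2_eq_square) algebra
        finally show ?thesis using 1 pos by (simp add: dz_def Let_def tk t_def[symmetric])
      next
        case 2
        have "u $ iN - inner (z (- e)) u * z (- e) $ iN
            = (1 - del\<^sup>2) * u $ iN + e * gam * del * u $ i1"
          using i1_neq_iN by (simp add: inner_z z_nth algebra_simps power2_eq_square)
        also have "1 - del\<^sup>2 = (e * e) * gam\<^sup>2" using unit e by simp
        also have "(e * e) * gam\<^sup>2 * u $ iN + e * gam * del * u $ i1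
            = e * gam * (del * u $ i1 + e * gam * u $ iN)"
          by (simp add: algebra_simps power2_eq_square)
        finally show ?thesis using 2 pos i1_neq_iN by (simp add: dz_def Let_def tk t_def[symmetric])
      next
        case 3
        then have "u $ j = (1 - alpha * lam j) * x $ j"
          by (simp add: u_def diag_matrix_mult_vec z_nth x_def algebra_simps)
        then show ?thesis using 3 by (simp add: dz_def Let_def z_nth)
      qed
    qed
    then have "(1 / kap) *\<^sub>R (u - inner (z (- e)) u *\<^sub>R z (- e)) = dz e g x"
      by (simp add: vec_eq_iff)
    then show ?thesis unfolding u_def g_def x_def .
  qed
  then show ?thesis
    unfolding mat_diff_scale
    using has_derivative_normalize[OF w nz] unfolding sg by simp
qed

lemma F_HDM_has_derivative:
  assumes e: "e * e = 1"
  shows "(F_HDM eta Lam has_derivative (\<lambda>h. (dalpha e h, dz e (dalpha e h) (snd h)))) (at (alpha, z e))"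
  using has_derivative_Pair[OF has_derivative_alpha_next_z[OF e]
      has_derivative_normalized_step[OF e has_derivative_alpha_next_z[OF e]]] alpha_next_z[OF e]
  by (simp add: F_HDM_def case_prod_beta' Let_def)

lemma F_OSGM_has_derivative:
  assumes e: "e * e = 1"
  shows "(F_OSGM eta Lam has_derivative (\<lambda>h. (dalpha e h, dz e (fst h) (snd h)))) (at (alpha, z e))"
  using has_derivative_Pair[OF has_derivative_alpha_next_z[OF e]
      has_derivative_normalized_step[OF e has_derivative_fst[OF has_derivative_ident]]]
  by (simp add: F_OSGM_def case_prod_beta' Let_def)


section \<open>Eigenvalues of the product of the Jacobians\<close>

text \<open>Both derivatives have this form: \<open>(a, b) = (c, beta)\<close> for HDM and \<open>(a, b) = (1, 0)\<close> for OSGM.\<close>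

definition step :: "real \<Rightarrow> real \<Rightarrow> real \<Rightarrow> real \<times> (real^'n) \<Rightarrow> real \<times> (real^'n)" where
  "step e a b h = (dalpha e h, dz e (a * fst h - b * e * tang e (snd h)) (snd h))"

definition ctang :: "real \<Rightarrow> complex^('n option) \<Rightarrow> complex" where
  "ctang e v = del * v $ Some i1 - e * gam * v $ Some iN"

lemma step_rows:
  fixes J :: "real^('n option)^('n option)" and v :: "complex^('n option)" and t :: complex
  assumes J: "\<And>y. J *v y = state_vec (step e a b (vec_state y))"
  defines "X \<equiv> map_matrix complex_of_real J *v v"
    and "t \<equiv> - ctang e v - e * m * (a * v $ None - b * e * ctang e v)"
  shows "X $ None = c * v $ None - beta * e * ctang e v"
    and "X $ Some i1 = del * t"
    and "X $ Some iN = e * gam * t"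
    and "j \<noteq> i1 \<Longrightarrow> j \<noteq> iN \<Longrightarrow> X $ Some j = ((1 - alpha * lam j) / kap) * v $ Some j"
  using i1_neq_iN
  by (simp_all add: X_def t_def map_matrix_of_real_mult_vec J step_def state_vec_def vec_state_def
      dalpha_def dz_def tang_def ctang_def Let_def complex_eq_iff)

context
  fixes J1 J2 :: "real^('n option)^('n option)" and a b :: real
  assumes J1: "\<And>y. J1 *v y = state_vec (step 1 a b (vec_state y))"
    and J2: "\<And>y. J2 *v y = state_vec (step (- 1) a b (vec_state y))"
begin

text \<open>The entries of the square of the matrix with rows \<open>(c, beta)\<close> and \<open>(- m a, 1 - m b)\<close>.\<close>

definition "mA = c\<^sup>2 - beta * m * a"
definition "mB = beta * (c + 1 - m * b)"
definition "mC = - m * a * (c + 1 - m * b)"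
definition "mD = (1 - m * b)\<^sup>2 - beta * m * a"

text \<open>The image under \<open>J2\<close> has tangential coordinate \<open>t\<close> at the
  other orbit point. If the sign of that coordinate is flipped between the factors, both act by the
  same 2 by 2 matrix on it and \<open>\<alpha>\<close>, which explains the square.\<close>

lemma two_step_rows:
  fixes v :: "complex^('n option)" and p :: complex
  defines "W \<equiv> map_matrix complex_of_real (J1 ** J2) *v v" and "p \<equiv> ctang (- 1) v"
  shows "W $ None = mA * v $ None + mB * p"
    and "W $ Some i1 = del * (mC * v $ None + mD * p)"
    and "W $ Some iN = gam * (mC * v $ None + mD * p)"
    and "j \<noteq> i1 \<Longrightarrow> j \<noteq> iN \<Longrightarrow> W $ Some j = ((1 - alpha * lam j) / kap)\<^sup>2 * v $ Some j"
proof -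
  define u where "u = map_matrix complex_of_real J2 *v v"
  have W: "W = map_matrix complex_of_real J1 *v u"
    by (simp add: W_def u_def map_matrix_of_real_mult matrix_vector_mul_assoc)
  note u = step_rows[OF J2, where v = v, folded u_def p_def]
  note Wu = step_rows[OF J1, where v = u, folded W]
  define t where "t = - p + m * (a * v $ None + b * p)"
  have "ctang 1 u = complex_of_real (gam\<^sup>2 + del\<^sup>2) * t"
    by (simp add: ctang_def u t_def algebra_simps power2_eq_square)
  then have ct: "ctang 1 u = t" unfolding unit by simp
  show "W $ None = mA * v $ None + mB * p"
    and "W $ Some i1 = del * (mC * v $ None + mD * p)"
    and "W $ Some iN = gam * (mC * v $ None + mD * p)"
    by (simp_all add: Wu(1-3) ct u(1) t_def mA_def mB_def mC_def mD_def algebra_simps power2_eq_square)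
  show "j \<noteq> i1 \<Longrightarrow> j \<noteq> iN \<Longrightarrow> W $ Some j = ((1 - alpha * lam j) / kap)\<^sup>2 * v $ Some j"
    by (simp add: Wu(4) u(4) power2_eq_square)
qed

lemma tr_eq: "mA + mD = c\<^sup>2 + (1 - m * b)\<^sup>2 - 2 * (beta * m * a)"
  by (simp add: mA_def mD_def)

lemma det_eq: "mA * mD - mB * mC = (c * (1 - m * b) + beta * m * a)\<^sup>2"
  by (simp add: mA_def mB_def mC_def mD_def) algebra

text \<open>If \<open>k\<close> is neither 0 nor a diagonal factor, the middle coordinates vanish
  and the pair \<open>(h, p)\<close> determines the eigenvector; so this pair is an eigenvector of
  the block.\<close>

lemma eigval_cases:
  assumes "k \<in> eigvals (map_matrix complex_of_real (J1 ** J2))"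
  obtains "k = 0" | j where "j \<noteq> i1" "j \<noteq> iN" "k = ((1 - alpha * lam j) / kap)\<^sup>2"
    | "k\<^sup>2 - of_real (mA + mD) * k + of_real (mA * mD - mB * mC) = 0"
proof -
  obtain v where v: "v \<noteq> 0" and kv: "map_matrix complex_of_real (J1 ** J2) *v v = k *s v"
    using assms by (auto simp: eigvals_def)
  define h p where "h = v $ None" and "p = ctang (- 1) v"
  note rows = two_step_rows[where v = v, unfolded kv, folded h_def p_def, simplified, folded h_def]
  show thesis
  proof (cases "k = 0 \<or> (\<exists>j. j \<noteq> i1 \<and> j \<noteq> iN \<and> k = ((1 - alpha * lam j) / kap)\<^sup>2)")
    case True
    then show ?thesis using that by auto
  next
    case False
    have mid: "v $ Some j = 0" if "j \<noteq> i1" "j \<noteq> iN" for j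
      using rows(4)[OF that] False that by auto
    have "k * p = del * (k * v $ Some i1) + gam * (k * v $ Some iN)"
      by (simp add: p_def ctang_def algebra_simps)
    also have "\<dots> = complex_of_real (gam\<^sup>2 + del\<^sup>2) * (mC * h + mD * p)"
      unfolding rows(2,3) by (simp add: algebra_simps power2_eq_square)
    finally have kp: "k * p = mC * h + mD * p" by (simp add: unit)
    have "h \<noteq> 0 \<or> p \<noteq> 0"
    proof (rule ccontr)
      assume "\<not> ?thesis"
      then have "v $ None = 0" "v $ Some i1 = 0" "v $ Some iN = 0"
        using rows(2,3) False by (auto simp: h_def)
      with mid have "v $ i = 0" for i by (cases i) (metis, metis)
      with v show False by (simp add: vec_eq_iff)
    qed
    moreover have "((k - mA) * (k - mD) - mB * mC) * h = 0" "((k - mA) * (k - mD) - mB * mC) * p = 0"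
    proof -
      \<comment> \<open>Multiplication by the adjugate of the block shifted by
        \<open>k\<close>.\<close>
      have "((k - mA) * (k - mD) - mB * mC) * h
          = (k - mD) * (k * h - (mA * h + mB * p)) + mB * (k * p - (mC * h + mD * p))"
        "((k - mA) * (k - mD) - mB * mC) * p
          = mC * (k * h - (mA * h + mB * p)) + (k - mA) * (k * p - (mC * h + mD * p))"
        by (simp_all add: algebra_simps)
      then show "((k - mA) * (k - mD) - mB * mC) * h = 0" "((k - mA) * (k - mD) - mB * mC) * p = 0"
        unfolding rows(1) kp by simp_all
    qed
    ultimately have "(k - mA) * (k - mD) - mB * mC = 0" by auto
    then have "k\<^sup>2 - of_real (mA + mD) * k + of_real (mA * mD - mB * mC) = 0"
      by (simp add: algebra_simps power2_eq_square)
    then show ?thesis using that by blast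
  qed
qed

lemma finite_eigvals: "finite (eigvals (map_matrix complex_of_real (J1 ** J2)))"
proof -
  obtain r1 r2 where r: "\<And>k. k\<^sup>2 - complex_of_real (mA + mD) * k + complex_of_real (mA * mD - mB * mC)
      = (k - r1) * (k - r2)"
    using complex_quadratic_factor by metis
  have "eigvals (map_matrix complex_of_real (J1 ** J2))
      \<subseteq> {0, r1, r2} \<union> range (\<lambda>j. ((1 - alpha * lam j) / kap)\<^sup>2)"
  proof
    fix k assume "k \<in> eigvals (map_matrix complex_of_real (J1 ** J2))"
    then show "k \<in> {0, r1, r2} \<union> range (\<lambda>j. ((1 - alpha * lam j) / kap)\<^sup>2)"
    proof (cases rule: eigval_cases)
      case 3
      then show ?thesis unfolding r by auto
    qed auto
  qed
  then show ?thesis by (rule finite_subset) auto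
qed

lemma zero_eigval: "0 \<in> eigvals (map_matrix complex_of_real (J1 ** J2))"
proof -
  \<comment> \<open>This is \<open>- z (- 1)\<close> with zero \<open>\<alpha>\<close>-component:
    the radial direction at the point where \<open>J2\<close> acts. Its eigenvalue 0 makes the set
    under \<open>Max\<close> non-empty.\<close>
  define v :: "complex^('n option)" where
    "v = (\<chi> i. if i = Some i1 then gam else if i = Some iN then - del else 0)"
  have v: "v $ None = 0" "v $ Some i1 = gam" "v $ Some iN = - del"
    "\<And>j. j \<noteq> i1 \<Longrightarrow> j \<noteq> iN \<Longrightarrow> v $ Some j = 0"
    using i1_neq_iN by (auto simp: v_def)
  have "ctang (- 1) v = 0" by (simp add: ctang_def v)
  then have "(map_matrix complex_of_real (J1 ** J2) *v v) $ i = 0" for i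
    using two_step_rows[where v = v] v by (cases i) (simp, metis mult_zero_right add_0)
  moreover have "v \<noteq> 0" using v(2) gam_nz by auto
  ultimately show ?thesis unfolding eigvals_def by (auto simp: vec_eq_iff intro!: exI[of _ v])
qed

lemma quadratic_root_eigval:
  assumes k: "k\<^sup>2 - complex_of_real (mA + mD) * k + complex_of_real (mA * mD - mB * mC) = 0"
    and "mB \<noteq> 0"
  shows "k \<in> eigvals (map_matrix complex_of_real (J1 ** J2))"
proof -
  \<comment> \<open>The block has eigenvector \<open>(mB, k - mA)\<close>; its second entry is
    lifted along the tangent \<open>del e1 + gam eN\<close> at \<open>z (- 1)\<close>.\<close>
  define v :: "complex^('n option)" where
    "v = (\<chi> i. case i of None \<Rightarrow> mB | Some j \<Rightarrow> (if j = i1 then del * (k - mA)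
        else if j = iN then gam * (k - mA) else 0))"
  have v: "v $ None = mB" "v $ Some i1 = del * (k - mA)" "v $ Some iN = gam * (k - mA)"
    "\<And>j. j \<noteq> i1 \<Longrightarrow> j \<noteq> iN \<Longrightarrow> v $ Some j = 0"
    using i1_neq_iN by (auto simp: v_def)
  have "ctang (- 1) v = complex_of_real (gam\<^sup>2 + del\<^sup>2) * (k - mA)"
    by (simp add: ctang_def v algebra_simps power2_eq_square)
  then have p: "ctang (- 1) v = k - mA" by (simp add: unit)
  have q: "complex_of_real mC * mB + mD * (k - mA) = k * (k - mA)"
    using k by (simp add: algebra_simps power2_eq_square)
  have "(map_matrix complex_of_real (J1 ** J2) *v v) $ i = k * v $ i" for i
  proof (cases i)
    case None
    then show ?thesis using two_step_rows(1)[of v] by (simp add: p v algebra_simps)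
  next
    case (Some j)
    then show ?thesis
      using two_step_rows(2-3)[of v] two_step_rows(4)[of j v] q v(4)[of j]
      using i1_neq_iN by (cases "j = i1"; cases "j = iN") (auto simp: p v(1-3) simp del: of_real_eq_iff)
  qed
  moreover have "v \<noteq> 0" using v(1) assms(2) by auto
  ultimately show ?thesis unfolding eigvals_def by (auto simp: vec_eq_iff intro!: exI[of _ v])
qed

lemma spectral_rad_less_1:
  assumes "\<bar>mA + mD\<bar> < 1 + (mA * mD - mB * mC)" "mA * mD - mB * mC < 1"
  shows "spectral_rad (J1 ** J2) < 1"
proof -
  have "cmod k < 1" if "k \<in> eigvals (map_matrix complex_of_real (J1 ** J2))" for k
    using that
  proof (cases rule: eigval_cases)
    case (2 j)
    \<comment> \<open>The factor is affine in the eigenvalue, with values \<open>kap\<close> at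
      \<open>mu\<close> and \<open>- kap\<close> at \<open>L\<close>.\<close>
    have "\<bar>1 - alpha * lam j\<bar> < kap"
    proof -
      have "alpha * mu < alpha * lam j" "alpha * lam j < alpha * L"
        using lam_between[OF 2(1,2)] pos(2) by (auto simp: alpha_def divide_strict_right_mono)
      then show ?thesis using alpha_eqs(1,2) by linarith
    qed
    then have "\<bar>(1 - alpha * lam j) / kap\<bar> < 1" using pos(4) by simp
    then have "((1 - alpha * lam j) / kap)\<^sup>2 < 1" using abs_square_less_1 by blast
    then show ?thesis unfolding 2(3) by (simp add: norm_power norm_divide abs_square_less_1 del: of_real_power)
  qed (use quadratic_roots_in_unit_disc[OF assms] in auto)
  then show ?thesis unfolding spectral_rad_def
    using finite_eigvals zero_eigval by (subst Max_less_iff) auto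
qed

text \<open>The determinant is the product of the two roots, so one root has modulus above
  1.\<close>

lemma spectral_rad_greater_1:
  assumes "1 < mA * mD - mB * mC" "mB \<noteq> 0"
  shows "1 < spectral_rad (J1 ** J2)"
proof -
  obtain r1 r2 where r: "\<And>k. k\<^sup>2 - complex_of_real (mA + mD) * k + complex_of_real (mA * mD - mB * mC)
      = (k - r1) * (k - r2)" and det: "r1 * r2 = complex_of_real (mA * mD - mB * mC)"
    using complex_quadratic_factor by metis
  have "cmod r1 * cmod r2 = \<bar>mA * mD - mB * mC\<bar>"
    unfolding norm_mult[symmetric] det by (rule norm_of_real)
  then have "1 < cmod r1 * cmod r2" using assms(1) by linarith
  then have "1 < cmod r1 \<or> 1 < cmod r2"
    by (smt (verit) mult_le_one norm_ge_zero)
  then obtain k where "1 < cmod k" "k = r1 \<or> k = r2" by blast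
  then have "k\<^sup>2 - complex_of_real (mA + mD) * k + complex_of_real (mA * mD - mB * mC) = 0"
    unfolding r by auto
  then have "k \<in> eigvals (map_matrix complex_of_real (J1 ** J2))"
    using assms(2) by (rule quadratic_root_eigval)
  then have "cmod k \<le> spectral_rad (J1 ** J2)" unfolding spectral_rad_def
    using finite_eigvals by (intro Max_ge) auto
  with \<open>1 < cmod k\<close> show ?thesis by linarith
qed

end

section \<open>Trace and determinant for the two systems\<close>

lemma theta:
  shows "beta * m = eta * (L + mu)" "0 < eta * (L + mu)" "eta * (L + mu) < 2"
    "c = 1 - eta * (L + mu) / 2"
proof -
  show "beta * m = eta * (L + mu)"
    using pos gam_nz del_nz by (simp add: beta_def m_def)
  show "0 < eta * (L + mu)" using eta_pos pos by simp
  have "eta * (L + mu) \<le> 1 / L * (L + mu)"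
    using eta_le pos by (intro mult_right_mono) auto
  also have "\<dots> < 2" using mu_less pos by (simp add: field_simps)
  finally show "eta * (L + mu) < 2" .
qed (simp add: c_def)

lemma state_jacobian_F_HDM:
  assumes "e * e = 1"
  shows "state_jacobian (F_HDM eta Lam) (alpha, z e) *v y = state_vec (step e c beta (vec_state y))"
  using state_jacobian_mult_vec[OF F_HDM_has_derivative[OF assms], of y]
  by (simp add: step_def dalpha_def)

lemma state_jacobian_F_OSGM:
  assumes "e * e = 1"
  shows "state_jacobian (F_OSGM eta Lam) (alpha, z e) *v y = state_vec (step e 1 0 (vec_state y))"
  using state_jacobian_mult_vec[OF F_OSGM_has_derivative[OF assms], of y]
  by (simp add: step_def)

lemma spectral_rad_HDM:
  "spectral_rad (state_jacobian (F_HDM eta Lam) (alpha, z 1) **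
    state_jacobian (F_HDM eta Lam) (alpha, z (- 1))) < 1"
proof -
  define th where "th = eta * (L + mu)"
  note th = theta[folded th_def]
  note J = state_jacobian_F_HDM[of 1, simplified] state_jacobian_F_HDM[of "- 1", simplified]
  have mb: "m * beta = th" using th(1) by (simp add: mult.commute)
  \<comment> \<open>Here \<open>det M = c * (1 - th) + th * c = c\<close>.\<close>
  have det: "mA c * mD c beta - mB beta * mC c beta = c\<^sup>2"
    unfolding det_eq[OF J] mb th(1) by (simp add: algebra_simps)
  have "mA c + mD c beta = (c + 1 - th)\<^sup>2 - 2 * c"
    unfolding tr_eq[OF J] mb th(1) by (simp add: algebra_simps power2_eq_square)
  moreover have "\<bar>c + 1 - th\<bar> < 1 + c" "0 < c" "c < 1"
    using th by auto
  then have "(c + 1 - th)\<^sup>2 < (1 + c)\<^sup>2" "c\<^sup>2 < 1" "0 < (1 - c)\<^sup>2"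
    by (auto simp: abs_square_less_1 intro: power2_strict_mono)
  moreover have "(1 + c)\<^sup>2 = 1 + 2 * c + c\<^sup>2" "(1 - c)\<^sup>2 = 1 - 2 * c + c\<^sup>2" "0 \<le> (c + 1 - th)\<^sup>2"
    by (simp add: power2_sum, simp add: power2_diff, simp)
  \<comment> \<open>The trace of the square is \<open>(tr M)^2 - 2 * c\<close>. The upper bound
    comes from \<open>\<bar>tr M\<bar> < 1 + c\<close>, the lower one from
    \<open>- 2 * c > - (1 + c^2)\<close>.\<close>
  ultimately have "\<bar>mA c + mD c beta\<bar> < 1 + c\<^sup>2" "c\<^sup>2 < 1"
    by linarith+
  then show ?thesis
    by (intro spectral_rad_less_1[OF J]) (simp_all only: det)
qed

lemma spectral_rad_OSGM:
  "1 < spectral_rad (state_jacobian (F_OSGM eta Lam) (alpha, z 1) **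
    state_jacobian (F_OSGM eta Lam) (alpha, z (- 1)))"
proof -
  define th where "th = eta * (L + mu)"
  note th = theta[folded th_def]
  note J = state_jacobian_F_OSGM[of 1, simplified] state_jacobian_F_OSGM[of "- 1", simplified]
  have "mA 1 * mD 1 0 - mB 0 * mC 1 0 = (1 + th / 2)\<^sup>2"
    unfolding det_eq[OF J] th(1) by (simp add: th(4) algebra_simps)
  moreover have "1 < (1 + th / 2)\<^sup>2"
    using th(2) by (intro one_less_power) auto
  \<comment> \<open>\<open>mB 0\<close> is \<open>beta * (c + 1)\<close>, where
    \<open>beta * m = th > 0\<close> and \<open>c > 0\<close>.\<close>
  moreover have "mB 0 \<noteq> 0"
    using th(1-4) by (auto simp: mB_def[OF J])
  ultimately show ?thesis
    by (intro spectral_rad_greater_1[OF J]) simp_all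
qed

end

section \<open>Specialization to the given orbit\<close>

theorem theorem2p1:
  fixes A Lam :: "real^('n::{finite,linorder})^('n::{finite,linorder})"
    and lam :: "'n \<Rightarrow> real"
    and L mu eta alpha gam del :: real
    and i1 iN :: 'n
    and z1 z2 :: "real^('n::{finite,linorder})"
  assumes "CARD('n) \<ge> 2"
    and "sym_pos_def A"
    and "eigvals A = range lam"
    and "\<And>i j. i < j \<Longrightarrow> lam j < lam i"
    and "i1 = Min UNIV" and "iN = Max UNIV"
    and "L = lam i1" and "mu = lam iN" and "mu > 0"
    and "Lam = diag_matrix lam"
    and "alpha = 2 / (L + mu)"
    and "gam = mu / sqrt (L^2 + mu^2)"
    and "del = L / sqrt (L^2 + mu^2) \<or> del = - (L / sqrt (L^2 + mu^2))"
    and "z1 = gam *\<^sub>R axis i1 1 + del *\<^sub>R axis iN 1"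
    and "z2 = - gam *\<^sub>R axis i1 1 + del *\<^sub>R axis iN 1"
    and "0 < eta" and "eta \<le> 1 / L"
  shows "period_two_orbit (F_HDM eta Lam) (alpha, z1) (alpha, z2) \<and>
         period_two_orbit (F_OSGM eta Lam) (alpha, z1) (alpha, z2) \<and>
         (\<forall>s \<in> {(alpha, z1), (alpha, z2)}.
           F_HDM eta Lam differentiable (at s) \<and> F_OSGM eta Lam differentiable (at s)) \<and>
         spectral_rad (state_jacobian (F_HDM eta Lam) (alpha, z1) **
                       state_jacobian (F_HDM eta Lam) (alpha, z2)) < 1 \<and>
         spectral_rad (state_jacobian (F_OSGM eta Lam) (alpha, z1) **
                       state_jacobian (F_OSGM eta Lam) (alpha, z2)) > 1"
proof -
  have lt: "lam j < L" if "j \<noteq> i1" for j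
  proof -
    have "i1 \<le> j" using assms(5) by simp
    then show ?thesis using that assms(4)[of i1 j] assms(7) by simp
  qed
  have gt: "mu < lam j" if "j \<noteq> iN" for j
  proof -
    have "j \<le> iN" using assms(6) by simp
    then show ?thesis using that assms(4)[of j iN] assms(8) by simp
  qed
  have "i1 \<noteq> iN"
  proof
    assume "i1 = iN"
    have "j = i1" for j :: 'n
    proof (rule antisym)
      show "j \<le> i1" using \<open>i1 = iN\<close> assms(6) by simp
      show "i1 \<le> j" using assms(5) by simp
    qed
    then have "CARD('n) \<le> 1"
      using card_mono[of "{i1}" "UNIV :: 'n set"] by auto
    with assms(1) show False by simp
  qed
  then have muL: "mu < L" using lt[of iN] assms(8) by simp
  define r where "r = sqrt (L\<^sup>2 + mu\<^sup>2)"
  have r: "r\<^sup>2 = L\<^sup>2 + mu\<^sup>2" "0 < r"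
    using assms(9) by (auto simp: r_def intro: add_nonneg_pos)
  have gam: "gam = mu / r" and del: "del = L / r \<or> del = - (L / r)"
    using assms(12,13) by (simp_all add: r_def)
  have del2: "del\<^sup>2 = L\<^sup>2 / r\<^sup>2" using del by (auto simp: power_divide)
  interpret two_cycle lam i1 iN L mu eta gam del
  proof
    show "gam\<^sup>2 + del\<^sup>2 = 1"
      using r assms(9) unfolding del2 gam power_divide by (simp add: add_divide_distrib[symmetric])
    show "L\<^sup>2 * gam\<^sup>2 = mu\<^sup>2 * del\<^sup>2"
      unfolding del2 gam power_divide by simp
  qed (use assms(7-9,16,17) lt gt muL r(2) gam del in auto)
  have alpha: "alpha = two_cycle.alpha L mu"
    using assms(11) by (simp add: alpha_def)
  have z1: "z1 = z 1" and z2: "z2 = z (- 1)"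
    using assms(14,15) by (simp_all add: z_def)
  have "z 1 $ i1 \<noteq> z (- 1) $ i1"
    using gam_nz by (simp add: z_nth)
  then have "z 1 \<noteq> z (- 1)" by auto
  \<comment> \<open>The derivatives also yield differentiability, so the values of the total
    function \<open>jacobian\<close> are genuine Jacobians.\<close>
  then show ?thesis
    unfolding z1 z2 assms(10) alpha period_two_orbit_def
    using orbit[of 1] orbit[of "- 1"] spectral_rad_HDM spectral_rad_OSGM
      F_HDM_has_derivative[of 1] F_HDM_has_derivative[of "- 1"]
      F_OSGM_has_derivative[of 1] F_OSGM_has_derivative[of "- 1"]
    by (auto simp: differentiable_def)
qed

end
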